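(* Let $n\ge2$. Then $$\frac1{n!}\sum_{g\in\mathfrak S_n}\varepsilon(g)\,(\mathrm{fix}(g)-1)=\begin{cases}-\frac12,&\varepsilon=\mathrm{maj},\\[2pt]-\frac1n,&\varepsilon=\mathrm{des},\\[2pt]-\frac{n+1}6,&\varepsilon=\mathrm{inv}.\end{cases}$$
   Context: $\mathfrak S_n$ is the symmetric group on $\{1,\dots,n\}$. For $\sigma\in\mathfrak S_n$: $\mathrm{Des}(\sigma)=\{i\in\{1,\dots,n-1\}:\sigma(i)>\sigma(i+1)\}$, $\mathrm{des}(\sigma)=\#\mathrm{Des}(\sigma)$, $\mathrm{maj}(\sigma)=\sum_{i\in\mathrm{Des}(\sigma)}i$, $\mathrm{inv}(\sigma)=\#\{i<j:\sigma(i)>\sigma(j)\}$, $\mathrm{fix}(\sigma)=\#\{i\in\{1,\dots,n\}:\sigma(i)=i\}$. *)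

theory Defs
  imports Complex_Main "HOL-Combinatorics.Permutations"
begin

text \<open>Elements of the symmetric group of degree \<open>n\<close> are the functions \<open>\<sigma> :: nat \<Rightarrow> nat\<close> with
  \<^term>\<open>\<sigma> permutes {1..n::nat}\<close>. They are the identity outside \<open>{1..n}\<close>, so all statistics
  carry \<open>n\<close> explicitly.\<close>

definition descent_set :: "nat \<Rightarrow> (nat \<Rightarrow> nat) \<Rightarrow> nat set" where
  "descent_set n \<sigma> = {i \<in> {1..n - 1}. \<sigma> i > \<sigma> (i + 1)}"

definition des :: "nat \<Rightarrow> (nat \<Rightarrow> nat) \<Rightarrow> nat" where
  "des n \<sigma> = card (descent_set n \<sigma>)"

definition maj :: "nat \<Rightarrow> (nat \<Rightarrow> nat) \<Rightarrow> nat" where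
  "maj n \<sigma> = (\<Sum>i\<in>descent_set n \<sigma>. i)"

text \<open>The inversion number; the name \<open>inv\<close> is taken by the inverse function.\<close>

definition inv_number :: "nat \<Rightarrow> (nat \<Rightarrow> nat) \<Rightarrow> nat" where
  "inv_number n \<sigma> = card {(i, j). i \<in> {1..n} \<and> j \<in> {1..n} \<and> i < j \<and> \<sigma> i > \<sigma> j}"

definition fix_count :: "nat \<Rightarrow> (nat \<Rightarrow> nat) \<Rightarrow> nat" where
  "fix_count n \<sigma> = card {i \<in> {1..n}. \<sigma> i = i}"

end

theory Submission
  imports Defs
begin

text \<open>By linearity it suffices to sum \<open>fix g - 1\<close> over the permutations with a given inversion
  \<open>g i > g j\<close>, \<open>i < j\<close>. Exchanging the values at \<open>i\<close> and \<open>j\<close> shows that a fixed point outside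
  \<open>{i, j}\<close> occurs in \<open>(n-1)!/2\<close> of them, while the fixed points \<open>i\<close> and \<open>j\<close> occur in
  \<open>(i-1) (n-2)!\<close> and \<open>(n-j) (n-2)!\<close> of them. Subtracting their number \<open>n!/2\<close> leaves
  \<open>-(j-i) (n-2)!\<close>, and each statistic is a weighted sum of indicators of inversions.\<close>

lemma permutes_fixing_eq: "{g. g permutes S \<and> g k = k} = {g. g permutes (S - {k})}"
proof (intro set_eqI iffI)
  fix g assume "g \<in> {g. g permutes S \<and> g k = k}"
  then show "g \<in> {g. g permutes (S - {k})}"
    by (auto intro: permutes_superset)
next
  fix g assume "g \<in> {g. g permutes (S - {k})}"
  then show "g \<in> {g. g permutes S \<and> g k = k}"
    by (auto intro: permutes_subset simp: permutes_not_in)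
qed

text \<open>Composing on the left with the transposition of \<open>j\<close> and \<open>b\<close>
  turns the value \<open>b\<close> at \<open>j\<close> into a fixed point \<open>j\<close>; what
  remains is an arbitrary permutation of \<open>S - {j}\<close>.\<close>

lemma card_permutes_value:
  assumes "finite S" "j \<in> S" "b \<in> S"
  shows "card {g. g permutes S \<and> g j = b} = fact (card S - 1)"
proof -
  let ?t = "Transposition.transpose j b"
  have "bij_betw (\<lambda>g. ?t \<circ> g) {g. g permutes S \<and> g j = b} {g. g permutes S \<and> g j = j}"
    by (rule bij_betw_byWitness[where f' = "\<lambda>g. ?t \<circ> g"])
      (use assms in \<open>auto simp: permutes_compose permutes_swap_id fun_eq_iff\<close>)
  then have "card {g. g permutes S \<and> g j = b} = card {g. g permutes (S - {j})}"
    by (simp add: bij_betw_same_card flip: permutes_fixing_eq)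
  also have "\<dots> = fact (card S - 1)"
    using assms by (intro card_permutations) auto
  finally show ?thesis .
qed

lemma card_permutes_value_in:
  assumes "finite S" "j \<in> S" "B \<subseteq> S"
  shows "card {g. g permutes S \<and> g j \<in> B} = card B * fact (card S - 1)"
proof -
  have "{g. g permutes S \<and> g j \<in> B} = (\<Union>b\<in>B. {g. g permutes S \<and> g j = b})"
    by auto
  also have "card \<dots> = (\<Sum>b\<in>B. card {g. g permutes S \<and> g j = b})"
    using assms finite_subset[OF assms(3)]
    by (intro card_UN_disjoint) (auto simp: finite_permutations)
  also have "\<dots> = card B * fact (card S - 1)"
    using assms by (subst sum.cong[OF refl card_permutes_value]) auto
  finally show ?thesis .
qed

text \<open>Composing on the right with the transposition of \<open>i\<close> and \<open>j\<close>
  matches the permutations with \<open>g i > g j\<close> with those with \<open>g i < g j\<close>.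
  The set \<open>S\<close> is general because both \<open>{1..n}\<close> and \<open>{1..n}\<close>
  without a fixed point occur below.\<close>

lemma card_permutes_inversion:
  fixes S :: "'a::linorder set"
  assumes "finite S" "i \<in> S" "j \<in> S" "i \<noteq> j"
  shows "2 * card {g. g permutes S \<and> g i > g j} = fact (card S)"
proof -
  let ?t = "Transposition.transpose i j"
  let ?A = "{g. g permutes S \<and> g i > g j}" and ?B = "{g. g permutes S \<and> g i < g j}"
  have t: "?t permutes S"
    using assms by (simp add: permutes_swap_id)
  have "bij_betw (\<lambda>g. g \<circ> ?t) ?A ?B"
    by (rule bij_betw_byWitness[where f' = "\<lambda>g. g \<circ> ?t"])
      (auto simp: permutes_compose[OF t] fun_eq_iff)
  then have "card ?A = card ?B"
    by (rule bij_betw_same_card)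
  moreover have "g i < g j \<or> g i > g j" if "g permutes S" for g
    using permutes_inj[OF that] assms(4) by (simp add: inj_eq flip: neq_iff)
  then have "?A \<union> ?B = {g. g permutes S}"
    by blast
  moreover have "card (?A \<union> ?B) = card ?A + card ?B"
    using assms(1) by (intro card_Un_disjoint) (auto simp: finite_permutations)
  ultimately show ?thesis
    using card_permutations[OF refl assms(1)] by simp
qed

lemma sum_fix_count_inversion:
  assumes "1 \<le> i" "i < j" "j \<le> n"
  shows "(\<Sum>g | g permutes {1..n}. of_bool (g i > g j) * (real (fix_count n g) - 1))
    = - (real j - real i) * fact (n - 2)"
proof -
  let ?P = "{g. g permutes {1..n}}"
  let ?N = "\<lambda>k. card {g. g permutes ({1..n} - {k}) \<and> g i > g j}"
  have fin: "finite ?P"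
    by (simp add: finite_permutations)
  \<comment> \<open>Every factorial is reduced to a multiple of \<open>fact (n - 2)\<close>, so that
    the conclusion becomes a polynomial identity in \<open>i\<close>, \<open>j\<close> and
    \<open>n\<close>.\<close>
  have n: "n = Suc (Suc (n - 2))"
    using assms by simp
  have fact1: "fact (n - 1) = (real n - 1) * fact (n - 2)"
    by (subst n, subst (2) n) simp
  have fact2: "fact n = real n * (real n - 1) * fact (n - 2)"
    by (subst n, subst (2) n, subst (3) n) (simp add: algebra_simps)
  have fix_sum: "real (fix_count n g) = (\<Sum>k\<in>{1..n}. of_bool (g k = k))" for g
    by (simp add: fix_count_def Int_def flip: of_nat_sum)
  have card_N: "(\<Sum>g\<in>?P. of_bool (g i > g j) * of_bool (g k = k)) = real (?N k)" for k
  proof -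
    have "{g \<in> ?P. g i > g j \<and> g k = k} = {g. g permutes ({1..n} - {k}) \<and> g i > g j}"
      using permutes_fixing_eq[of "{1..n}" k] by blast
    then show ?thesis
      using fin by (simp add: Int_def flip: of_bool_conj of_nat_sum)
  qed
  have N_other: "real (?N k) = (real n - 1) * fact (n - 2) / 2" if "k \<in> {1..n} - {i, j}" for k
  proof -
    have "2 * ?N k = fact (card ({1..n} - {k}))"
      using that assms by (intro card_permutes_inversion) auto
    also have "\<dots> = fact (n - 1)"
      using that by simp
    finally have "real (2 * ?N k) = fact (n - 1)"
      by (simp only: of_nat_fact)
    then show ?thesis
      using fact1 by simp
  qed
  \<comment> \<open>Here \<open>g i = i\<close>, so the inversion only says that \<open>g j\<close>
    is one of the \<open>i - 1\<close> values below \<open>i\<close>.\<close>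
  have N_i: "real (?N i) = (real i - 1) * fact (n - 2)"
  proof -
    have "{g. g permutes ({1..n} - {i}) \<and> g i > g j}
        = {g. g permutes ({1..n} - {i}) \<and> g j \<in> {1..<i}}"
      using assms permutes_in_image[of _ "{1..n} - {i}" j]
      by (auto simp: permutes_not_in)
    moreover have "card \<dots> = card {1..<i} * fact (card ({1..n} - {i}) - 1)"
      using assms by (intro card_permutes_value_in) auto
    ultimately show ?thesis
      using assms by (simp add: of_nat_diff numeral_2_eq_2)
  qed
  \<comment> \<open>Dually \<open>g j = j\<close>, and \<open>g i\<close> is one of the
    \<open>n - j\<close> values above \<open>j\<close>.\<close>
  have N_j: "real (?N j) = (real n - real j) * fact (n - 2)"
  proof -
    have "{g. g permutes ({1..n} - {j}) \<and> g i > g j}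
        = {g. g permutes ({1..n} - {j}) \<and> g i \<in> {j<..n}}"
      using assms permutes_in_image[of _ "{1..n} - {j}" i]
      by (auto simp: permutes_not_in)
    moreover have "card \<dots> = card {j<..n} * fact (card ({1..n} - {j}) - 1)"
      using assms by (intro card_permutes_value_in) auto
    ultimately show ?thesis
      using assms by (simp add: of_nat_diff numeral_2_eq_2)
  qed
  have all: "(\<Sum>g\<in>?P. of_bool (g i > g j)) = real n * (real n - 1) * fact (n - 2) / 2"
  proof -
    have "2 * card {g. g permutes {1..n} \<and> g i > g j} = fact (card {1..n})"
      using assms by (intro card_permutes_inversion) auto
    then have "real (2 * card {g. g permutes {1..n} \<and> g i > g j}) = fact n"
      by (simp only: of_nat_fact card_atLeastAtMost diff_Suc_1)
    then show ?thesis
      using fin by (simp add: Int_def fact2 flip: of_nat_sum)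
  qed
  have "(\<Sum>g\<in>?P. of_bool (g i > g j) * (real (fix_count n g) - 1))
      = (\<Sum>g\<in>?P. \<Sum>k\<in>{1..n}. of_bool (g i > g j) * of_bool (g k = k))
        - (\<Sum>g\<in>?P. of_bool (g i > g j))"
    by (simp only: fix_sum right_diff_distrib mult_1_right sum_subtractf sum_distrib_left)
  also have "(\<Sum>g\<in>?P. \<Sum>k\<in>{1..n}. of_bool (g i > g j) * of_bool (g k = k))
      = (\<Sum>k\<in>{1..n}. real (?N k))"
    by (subst sum.swap) (simp only: card_N)
  also have "\<dots> = real (?N i) + real (?N j) + (\<Sum>k\<in>{1..n} - {i, j}. real (?N k))"
    using assms by (subst sum.subset_diff[of "{i, j}"]) auto
  also have "(\<Sum>k\<in>{1..n} - {i, j}. real (?N k))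
      = (real n - 2) * ((real n - 1) * fact (n - 2) / 2)"
    using assms by (subst sum.cong[OF refl N_other]) (auto simp: card_Diff_subset of_nat_diff)
  \<comment> \<open>In units of \<open>fact (n - 2)\<close> the total is (i-1) + (n-j) +
    (n-2)(n-1)/2 - n(n-1)/2 = i - j.\<close>
  finally show ?thesis
    unfolding N_i N_j all by (simp add: field_simps)
qed

text \<open>Exchanging the two sums reduces the claim to single pairs of positions. The free index
  set and weights cover all three statistics: adjacent pairs with weight \<open>i\<close> or 1, and
  all pairs with weight 1.\<close>

lemma sum_weighted_inversions:
  assumes "\<And>x. x \<in> X \<Longrightarrow> 1 \<le> a x \<and> a x < b x \<and> b x \<le> n"
    and "\<And>g. f g = (\<Sum>x\<in>X. w x * of_bool (g (a x) > g (b x)))"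
  shows "(\<Sum>g | g permutes {1..n}. f g * (real (fix_count n g) - 1))
    = - fact (n - 2) * (\<Sum>x\<in>X. w x * (real (b x) - real (a x)))"
proof -
  let ?P = "{g. g permutes {1..n}}"
  have "(\<Sum>g\<in>?P. f g * (real (fix_count n g) - 1))
      = (\<Sum>x\<in>X. w x * (\<Sum>g\<in>?P. of_bool (g (a x) > g (b x)) * (real (fix_count n g) - 1)))"
    unfolding assms(2) sum_distrib_right sum_distrib_left
    by (subst sum.swap) (simp only: mult.assoc)
  also have "\<dots> = (\<Sum>x\<in>X. w x * (- (real (b x) - real (a x)) * fact (n - 2)))"
    using assms(1) by (intro sum.cong refl) (subst sum_fix_count_inversion, auto)
  also have "\<dots> = - fact (n - 2) * (\<Sum>x\<in>X. w x * (real (b x) - real (a x)))"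
    by (simp add: sum_distrib_left algebra_simps sum_negf flip: sum_subtractf)
  finally show ?thesis .
qed

lemma maj_eq_sum: "real (maj n g) = (\<Sum>i\<in>{1..n - 1}. real i * of_bool (g i > g (Suc i)))"
  unfolding maj_def descent_set_def of_nat_sum
  by (subst sum.inter_filter, simp, rule sum.cong) auto

text \<open>The factor 1 is written out to match the weighted form in
  \<open>sum_weighted_inversions\<close>; likewise for \<open>inv_number\<close>.\<close>

lemma des_eq_sum: "real (des n g) = (\<Sum>i\<in>{1..n - 1}. 1 * of_bool (g i > g (Suc i)))"
  by (simp add: des_def descent_set_def Int_def flip: of_nat_sum)

text \<open>Pairs carry the larger position first, so that the gaps can later be summed over the
  smaller position for each fixed \<open>j\<close>.\<close>

lemma inv_number_eq_sum:
  "real (inv_number n g) = (\<Sum>x\<in>(SIGMA j:{1..n}. {1..<j}). 1 * of_bool (g (snd x) > g (fst x)))"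
proof -
  let ?X = "SIGMA j:{1..n}. {1..<j}"
  have "bij_betw prod.swap {(i, j). i \<in> {1..n} \<and> j \<in> {1..n} \<and> i < j \<and> g i > g j}
      {x \<in> ?X. g (snd x) > g (fst x)}"
    by (rule bij_betw_byWitness[where f' = prod.swap]) auto
  then have "inv_number n g = card {x \<in> ?X. g (snd x) > g (fst x)}"
    unfolding inv_number_def by (rule bij_betw_same_card)
  then show ?thesis
    by (simp add: Int_def flip: of_nat_sum)
qed

lemma sum_differences_below: "(\<Sum>i\<in>{1..<j}. real j - real i) = real j * (real j - 1) / 2"
proof (induction j)
  case (Suc j)
  show ?case
  \<comment> \<open>For \<open>j = 0\<close> the interval stays empty, and there is no top term
    \<open>i = j\<close> to split off.\<close>
  proof (cases "j = 0")
    case False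
    \<comment> \<open>Each of the \<open>j - 1\<close> old differences grows by 1, and the new index
      \<open>i = j\<close> contributes 1.\<close>
    have "(\<Sum>i\<in>{1..<Suc j}. real (Suc j) - real i) = (\<Sum>i\<in>{1..<j}. (real j - real i) + 1) + 1"
      using False by (simp add: algebra_simps)
    also have "\<dots> = real j * (real j - 1) / 2 + real (j - 1) + 1"
      by (simp only: sum.distrib Suc.IH) simp
    finally show ?thesis
      using False by (simp add: of_nat_diff field_simps)
  qed simp
qed simp

text \<open>The inner sums are the binomial coefficients C(j,2), and these add up to
  C(n+1,3).\<close>

lemma sum_differences:
  "(\<Sum>x\<in>(SIGMA j:{1..n}. {1..<j}). real (fst x) - real (snd x))
    = real n * (real n - 1) * (real n + 1) / 6"
proof -
  have "(\<Sum>x\<in>(SIGMA j:{1..n}. {1..<j}). real (fst x) - real (snd x))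
      = (\<Sum>j\<in>{1..n}. \<Sum>i\<in>{1..<j}. real j - real i)"
    by (subst sum.Sigma) (auto simp: case_prod_beta)
  also have "\<dots> = (\<Sum>j\<in>{1..n}. real j * (real j - 1) / 2)"
    by (simp only: sum_differences_below)
  also have "\<dots> = real n * (real n - 1) * (real n + 1) / 6"
    by (induction n) (simp_all add: field_simps)
  finally show ?thesis .
qed

theorem corollary4:
  fixes n :: nat
  assumes "n \<ge> 2"
  shows "1 / fact n * (\<Sum>g | g permutes {1..n}. real (maj n g) * (real (fix_count n g) - 1))
           = - (1 / 2 :: real) \<and>
         1 / fact n * (\<Sum>g | g permutes {1..n}. real (des n g) * (real (fix_count n g) - 1))
           = - (1 / real n) \<and>
         1 / fact n * (\<Sum>g | g permutes {1..n}. real (inv_number n g) * (real (fix_count n g) - 1))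
           = - ((real n + 1) / 6)"
proof -
  \<comment> \<open>This removes the truncated subtractions and lets the induction for
    \<open>gauss\<close> start at \<open>n = 2\<close>.\<close>
  obtain m where n: "n = Suc (Suc m)"
    using assms by (metis add_2_eq_Suc le_Suc_ex)
  have fact_n: "fact n = real n * (real n - 1) * fact (n - 2)"
    by (simp add: n algebra_simps)
  have nz: "real n \<noteq> 0" "real n - 1 \<noteq> 0"
    using assms by auto
  have gauss: "(\<Sum>i\<in>{1..n - 1}. real i) = real n * (real n - 1) / 2"
    unfolding n by (induction m) (simp_all add: field_simps)
  have "(\<Sum>g | g permutes {1..n}. real (maj n g) * (real (fix_count n g) - 1))
      = - fact (n - 2) * (\<Sum>i\<in>{1..n - 1}. real i * (real (Suc i) - real i))"
    \<comment> \<open>Adjacent positions have gap 1, so for \<open>maj\<close> and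
      \<open>des\<close> only the sum of the weights survives.\<close>
    by (intro sum_weighted_inversions maj_eq_sum) auto
  also have "\<dots> = - fact (n - 2) * (real n * (real n - 1) / 2)"
    by (simp flip: gauss)
  finally have maj: "(\<Sum>g | g permutes {1..n}. real (maj n g) * (real (fix_count n g) - 1))
      = - fact (n - 2) * (real n * (real n - 1) / 2)" .
  have "(\<Sum>g | g permutes {1..n}. real (des n g) * (real (fix_count n g) - 1))
      = - fact (n - 2) * (\<Sum>i\<in>{1..n - 1}. 1 * (real (Suc i) - real i))"
    by (intro sum_weighted_inversions des_eq_sum) auto
  also have "\<dots> = - fact (n - 2) * (real n - 1)"
    by (simp add: n)
  finally have des: "(\<Sum>g | g permutes {1..n}. real (des n g) * (real (fix_count n g) - 1))
      = - fact (n - 2) * (real n - 1)" .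
  have "(\<Sum>g | g permutes {1..n}. real (inv_number n g) * (real (fix_count n g) - 1))
      = - fact (n - 2)
        * (\<Sum>x\<in>(SIGMA j:{1..n}. {1..<j}). 1 * (real (fst x) - real (snd x)))"
    by (intro sum_weighted_inversions inv_number_eq_sum) auto
  also have "\<dots> = - fact (n - 2) * (real n * (real n - 1) * (real n + 1) / 6)"
    by (simp only: mult_1_left sum_differences)
  finally have inv: "(\<Sum>g | g permutes {1..n}. real (inv_number n g) * (real (fix_count n g) - 1))
      = - fact (n - 2) * (real n * (real n - 1) * (real n + 1) / 6)" .
  show ?thesis
    unfolding maj des inv fact_n using nz by simp
qed

end
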